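(* Let $Q$ be a finite quandle and let $\alpha: Tor(Z_0)\oplus Z_0/Tor(Z_0)\to Z_0$ be an isomorphism of groups. Let $V$ be a finite-dimensional complex Hermitian inner product space, $\rho:G(Q)_\alpha\to GL(V)$ an irreducible linear representation of the finite group $G(Q)_\alpha$ and $\chi$ a character of $Q$. Then the representation $\chi\cdot(\rho\circ\varphi_{Q,\alpha})$ of $Q$ takes values in the unitary group $U(V)$ if and only if $\rho$ is unitary (i.e. takes values in $U(V)$) and $\chi$ takes values in the complex numbers of modulus $1$.
   Context: A quandle is a set $Q$ with a binary operation $\triangleright$ such that $x\triangleright x=x$; $x\triangleright(y\triangleright z)=(x\triangleright y)\triangleright(x\triangleright z)$; and for all $x,y\in Q$ there is a unique $z\in Q$ with $x\triangleright z=y$. For $x\in Q$, $L_x:Q\to Q$ is the bijection $L_x(y)=x\triangleright y$; $Inn(Q)$ is the group of bijections of $Q$ generated by all $L_x$. The enveloping group is $G(Q)=\langle x\in Q\mid xyx^{-1}=x\triangleright y,\ x,y\in Q\rangle$, with $\varphi_Q:Q\to G(Q)$ sending $x$ to the corresponding generator. $\theta_{G(Q)}:G(Q)\to Inn(Q)$ is the surjective group morphism with $\theta_{G(Q)}(\varphi_Q(x))=L_x$, and $Z_0=\ker\theta_{G(Q)}$. It is known that $Z_0$ is contained in the center of $G(Q)$; for $Q$ finite, $Z_0$ is a finitely generated abelian group, with finite torsion subgroup $Tor(Z_0)$. Given $\alpha$ as in the claim, $G(Q)_\alpha=G(Q)/\alpha(Z_0/Tor(Z_0))$ (a finite group), $q_\alpha:G(Q)\to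 G(Q)_\alpha$ is the quotient map and $\varphi_{Q,\alpha}=q_\alpha\circ\varphi_Q$. A representation of $Q$ on $V$ is a map $\rho:Q\to GL(V)$ with $\rho(x\triangleright y)=\rho(x)\rho(y)\rho(x)^{-1}$. A character of $Q$ is a map $\chi:Q\to\mathbb{C}^\times$ with $\chi(x\triangleright y)=\chi(y)$ for all $x,y\in Q$; $(\chi\cdot\rho)(x)=\chi(x)\rho(x)$. Irreducible representations are nonzero. *)

theory Defs
  imports Complex_Main "HOL-Algebra.Generated_Groups" "HOL-Algebra.Bij"
begin

section \<open>Groups given by generators and relations\<close>

text \<open>The letter \<open>(True, x)\<close> stands for the generator \<open>x\<close> and \<open>(False, x)\<close> for its formal inverse.
  A relation \<open>u = v\<close> is given by the pair of words \<open>(u, v)\<close>.\<close>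

type_synonym 'a word = "(bool \<times> 'a) list"

definition words :: "'a set \<Rightarrow> 'a word set" where
  "words X = lists (UNIV \<times> X)"

inductive pres_eq :: "'a set \<Rightarrow> ('a word \<times> 'a word) set \<Rightarrow> 'a word \<Rightarrow> 'a word \<Rightarrow> bool"
  for X :: "'a set" and R :: "('a word \<times> 'a word) set" where
  refl: "w \<in> words X \<Longrightarrow> pres_eq X R w w"
| sym: "pres_eq X R u v \<Longrightarrow> pres_eq X R v u"
| trans: "pres_eq X R u v \<Longrightarrow> pres_eq X R v w \<Longrightarrow> pres_eq X R u w"
| append: "pres_eq X R u u' \<Longrightarrow> pres_eq X R v v' \<Longrightarrow> pres_eq X R (u @ v) (u' @ v')"
| cancel: "x \<in> X \<Longrightarrow> pres_eq X R [(b, x), (\<not> b, x)] []"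
| rel: "(u, v) \<in> R \<Longrightarrow> u \<in> words X \<Longrightarrow> v \<in> words X \<Longrightarrow> pres_eq X R u v"

definition pres_rel :: "'a set \<Rightarrow> ('a word \<times> 'a word) set \<Rightarrow> ('a word \<times> 'a word) set" where
  "pres_rel X R = {(u, v). pres_eq X R u v}"

definition pres_group :: "'a set \<Rightarrow> ('a word \<times> 'a word) set \<Rightarrow> 'a word set monoid" where
  "pres_group X R =
     \<lparr>carrier = words X // pres_rel X R,
      mult = (\<lambda>A B. \<Union>u\<in>A. \<Union>v\<in>B. pres_rel X R `` {u @ v}),
      one = pres_rel X R `` {[]}\<rparr>"

definition pres_gen :: "'a set \<Rightarrow> ('a word \<times> 'a word) set \<Rightarrow> 'a \<Rightarrow> 'a word set" where
  "pres_gen X R x = pres_rel X R `` {[(True, x)]}"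

fun word_eval :: "('g, 'm) monoid_scheme \<Rightarrow> ('a \<Rightarrow> 'g) \<Rightarrow> 'a word \<Rightarrow> 'g" where
  "word_eval H f [] = \<one>\<^bsub>H\<^esub>"
| "word_eval H f ((b, x) # w) = (if b then f x else inv\<^bsub>H\<^esub> f x) \<otimes>\<^bsub>H\<^esub> word_eval H f w"

text \<open>The morphism out of a presented group induced by \<open>f\<close> on the generators; it does not depend
  on the representative when \<open>f\<close> respects the relations, see \<open>pres_hom_class\<close>.\<close>

definition pres_hom :: "('g, 'm) monoid_scheme \<Rightarrow> ('a \<Rightarrow> 'g) \<Rightarrow> 'a word set \<Rightarrow> 'g" where
  "pres_hom H f A = word_eval H f (SOME w. w \<in> A)"

context
  fixes X :: "'a set" and R :: "('a word \<times> 'a word) set"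
begin

lemma words_simps [simp]:
  "[] \<in> words X" "(b, x) # w \<in> words X \<longleftrightarrow> x \<in> X \<and> w \<in> words X"
  "u @ v \<in> words X \<longleftrightarrow> u \<in> words X \<and> v \<in> words X"
  by (auto simp: words_def)

lemma pres_eq_words: "pres_eq X R u v \<Longrightarrow> u \<in> words X \<and> v \<in> words X"
  by (induction rule: pres_eq.induct) auto

lemma equiv_pres_rel: "equiv (words X) (pres_rel X R)"
proof (rule equivI)
  show "pres_rel X R \<subseteq> words X \<times> words X"
    by (auto simp: pres_rel_def dest: pres_eq_words)
  show "refl_on (words X) (pres_rel X R)"
    by (auto simp: refl_on_def pres_rel_def intro: pres_eq.refl)
  show "sym (pres_rel X R)"
    by (auto simp: sym_def pres_rel_def intro: pres_eq.sym)
  show "trans (pres_rel X R)"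
    by (auto simp: trans_def pres_rel_def intro: pres_eq.trans)
qed

lemma pres_class_eq: "pres_eq X R u v \<Longrightarrow> pres_rel X R `` {u} = pres_rel X R `` {v}"
  using equiv_class_eq[OF equiv_pres_rel] by (simp add: pres_rel_def)

lemma pres_mult_class:
  assumes "u \<in> words X" "v \<in> words X"
  shows "pres_rel X R `` {u} \<otimes>\<^bsub>pres_group X R\<^esub> pres_rel X R `` {v} = pres_rel X R `` {u @ v}"
proof -
  have "congruent2 (pres_rel X R) (pres_rel X R) (\<lambda>u v. pres_rel X R `` {u @ v})"
    by (rule congruent2I', rule pres_class_eq) (auto simp: pres_rel_def intro: pres_eq.append)
  then show ?thesis
    using UN_equiv_class2[OF equiv_pres_rel equiv_pres_rel] assms by (simp add: pres_group_def)
qed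

lemma pres_carrierE:
  assumes "A \<in> carrier (pres_group X R)"
  obtains w where "w \<in> words X" "A = pres_rel X R `` {w}"
  using assms by (auto simp: pres_group_def elim: quotientE)

lemma pres_class_carrier: "w \<in> words X \<Longrightarrow> pres_rel X R `` {w} \<in> carrier (pres_group X R)"
  by (auto simp: pres_group_def intro: quotientI)

lemma pres_inverse: "w \<in> words X \<Longrightarrow> \<exists>w'\<in>words X. pres_eq X R (w' @ w) []"
proof (induction w)
  case Nil
  then show ?case using pres_eq.refl[of "[]" X R] by (intro bexI[of _ "[]"]) auto
next
  case (Cons a w)
  obtain b x where a: "a = (b, x)" by (cases a)
  obtain w' where w': "w' \<in> words X" "pres_eq X R (w' @ w) []"
    using Cons by (auto simp: a)
  have x: "x \<in> X" using Cons.prems by (simp add: a)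
  have "pres_eq X R [(\<not> b, x), (b, x)] []"
    using pres_eq.cancel[OF x, of R "\<not> b"] by simp
  then have "pres_eq X R (w' @ ([(\<not> b, x), (b, x)] @ w)) (w' @ ([] @ w))"
    using w' Cons.prems by (intro pres_eq.append pres_eq.refl) (auto simp: a)
  then have "pres_eq X R ((w' @ [(\<not> b, x)]) @ (a # w)) []"
    using w'(2) pres_eq.trans by (fastforce simp: a)
  then show ?case using w'(1) x by (intro bexI[of _ "w' @ [(\<not> b, x)]"]) auto
qed

lemma pres_one: "\<one>\<^bsub>pres_group X R\<^esub> = pres_rel X R `` {[]}"
  by (simp add: pres_group_def)

lemma group_pres_group: "group (pres_group X R)"
proof (rule groupI)
  fix A assume "A \<in> carrier (pres_group X R)"
  then obtain w where w: "w \<in> words X" "A = pres_rel X R `` {w}" by (rule pres_carrierE)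
  show "\<one>\<^bsub>pres_group X R\<^esub> \<otimes>\<^bsub>pres_group X R\<^esub> A = A"
    using w by (simp add: pres_one pres_mult_class)
  obtain w' where w': "w' \<in> words X" "pres_eq X R (w' @ w) []" using pres_inverse w by blast
  show "\<exists>B\<in>carrier (pres_group X R). B \<otimes>\<^bsub>pres_group X R\<^esub> A = \<one>\<^bsub>pres_group X R\<^esub>"
    using w w' by (intro bexI[of _ "pres_rel X R `` {w'}"])
      (auto simp: pres_one pres_mult_class pres_class_carrier dest: pres_class_eq)
next
  fix A B C assume "A \<in> carrier (pres_group X R)" "B \<in> carrier (pres_group X R)"
    "C \<in> carrier (pres_group X R)"
  then show "A \<otimes>\<^bsub>pres_group X R\<^esub> B \<otimes>\<^bsub>pres_group X R\<^esub> C
      = A \<otimes>\<^bsub>pres_group X R\<^esub> (B \<otimes>\<^bsub>pres_group X R\<^esub> C)"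
    by (elim pres_carrierE) (simp add: pres_mult_class)
qed (auto elim!: pres_carrierE simp: pres_mult_class pres_class_carrier pres_one)

lemma pres_gen_carrier: "x \<in> X \<Longrightarrow> pres_gen X R x \<in> carrier (pres_group X R)"
  by (simp add: pres_gen_def pres_class_carrier)

lemma inv_pres_gen:
  assumes "x \<in> X"
  shows "inv\<^bsub>pres_group X R\<^esub> pres_gen X R x = pres_rel X R `` {[(False, x)]}"
  using assms pres_class_eq[OF pres_eq.cancel[OF assms, of R False]]
  by (intro group.inv_equality[OF group_pres_group])
    (simp_all add: pres_gen_def pres_mult_class pres_class_carrier pres_one)

lemma word_eval_pres_gen:
  "w \<in> words X \<Longrightarrow> word_eval (pres_group X R) (pres_gen X R) w = pres_rel X R `` {w}"
proof (induction w)
  case (Cons a w)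
  then show ?case
    by (cases a) (auto simp: inv_pres_gen, auto simp: pres_gen_def pres_mult_class)
qed (simp add: pres_one)

end

lemma (in group) word_eval_closed:
  "f ` X \<subseteq> carrier G \<Longrightarrow> w \<in> words X \<Longrightarrow> word_eval G f w \<in> carrier G"
proof (induction w)
  case (Cons a w)
  then show ?case by (cases a) auto
qed simp

lemma (in group) word_eval_append:
  "f ` X \<subseteq> carrier G \<Longrightarrow> u \<in> words X \<Longrightarrow> v \<in> words X \<Longrightarrow>
    word_eval G f (u @ v) = word_eval G f u \<otimes> word_eval G f v"
proof (induction u)
  case Nil
  then show ?case using word_eval_closed[of f X v] by simp
next
  case (Cons a u)
  then show ?case
    using word_eval_closed[of f X u] word_eval_closed[of f X v]
    by (cases a) (auto simp: m_assoc image_subset_iff)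
qed

lemma (in group) word_eval_cong:
  assumes f: "f ` X \<subseteq> carrier G"
    and R: "\<And>u v. (u, v) \<in> R \<Longrightarrow> u \<in> words X \<Longrightarrow> v \<in> words X \<Longrightarrow> word_eval G f u = word_eval G f v"
    and "pres_eq X R u v"
  shows "word_eval G f u = word_eval G f v"
  using assms(3)
proof (induction rule: pres_eq.induct)
  case (append u u' v v')
  then show ?case
    using word_eval_append[OF f] by (metis pres_eq_words)
next
  case (cancel x b)
  then have "f x \<in> carrier G" using f by auto
  then show ?case by simp
qed (auto simp: R)

lemma (in group) pres_hom_class:
  assumes "f ` X \<subseteq> carrier G"
    and "\<And>u v. (u, v) \<in> R \<Longrightarrow> u \<in> words X \<Longrightarrow> v \<in> words X \<Longrightarrow> word_eval G f u = word_eval G f v"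
    and "w \<in> words X"
  shows "pres_hom G f (pres_rel X R `` {w}) = word_eval G f w"
proof -
  have "w \<in> pres_rel X R `` {w}" using assms(3) by (simp add: pres_rel_def pres_eq.refl)
  then have "(SOME u. u \<in> pres_rel X R `` {w}) \<in> pres_rel X R `` {w}" by (rule someI)
  then show ?thesis
    using word_eval_cong[of f X R w, OF assms(1,2)] by (simp add: pres_hom_def pres_rel_def)
qed

lemma (in group) pres_hom_hom:
  assumes f: "f ` X \<subseteq> carrier G"
    and R: "\<And>u v. (u, v) \<in> R \<Longrightarrow> u \<in> words X \<Longrightarrow> v \<in> words X \<Longrightarrow> word_eval G f u = word_eval G f v"
  shows "pres_hom G f \<in> hom (pres_group X R) G"
    and "x \<in> X \<Longrightarrow> pres_hom G f (pres_gen X R x) = f x"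
proof -
  note c = pres_hom_class[of f X R, OF f R]
  show "pres_hom G f \<in> hom (pres_group X R) G"
  proof (rule homI)
    fix A assume "A \<in> carrier (pres_group X R)"
    then show "pres_hom G f A \<in> carrier G"
      by (elim pres_carrierE) (simp add: c word_eval_closed[OF f])
  next
    fix A B assume "A \<in> carrier (pres_group X R)" "B \<in> carrier (pres_group X R)"
    then show "pres_hom G f (A \<otimes>\<^bsub>pres_group X R\<^esub> B) = pres_hom G f A \<otimes> pres_hom G f B"
      by (elim pres_carrierE) (simp add: c pres_mult_class word_eval_append[OF f])
  qed
  show "x \<in> X \<Longrightarrow> pres_hom G f (pres_gen X R x) = f x"
    using f by (auto simp: pres_gen_def c)
qed

lemma pres_hom_unique:
  assumes "group H" and h: "h \<in> hom (pres_group X R) H" and f: "\<And>x. x \<in> X \<Longrightarrow> h (pres_gen X R x) = f x"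
    and "w \<in> words X"
  shows "h (pres_rel X R `` {w}) = word_eval H f w"
  using assms(4)
proof (induction w)
  interpret group_hom "pres_group X R" H h
    using assms(1) h by (simp add: group_hom_def group_hom_axioms_def group_pres_group)
  {
    case Nil
    then show ?case using hom_one by (simp add: pres_one)
  next
    case (Cons a w)
    obtain b x where a: "a = (b, x)" by (cases a)
    have x: "x \<in> X" and w: "w \<in> words X" using Cons.prems by (simp_all add: a)
    have "pres_rel X R `` {a # w} = pres_rel X R `` {[a]} \<otimes>\<^bsub>pres_group X R\<^esub> pres_rel X R `` {w}"
      using x w by (simp add: a pres_mult_class)
    then have "h (pres_rel X R `` {a # w}) = h (pres_rel X R `` {[a]}) \<otimes>\<^bsub>H\<^esub> word_eval H f w"
      using Cons.IH x w by (simp add: a pres_class_carrier)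
    moreover have "h (pres_rel X R `` {[a]}) = (if b then f x else inv\<^bsub>H\<^esub> f x)"
      using f[OF x] hom_inv[OF pres_gen_carrier[OF x]] x
      by (simp add: a inv_pres_gen) (simp add: pres_gen_def)
    ultimately show ?case by (simp add: a)
  }
qed

section \<open>Quandles\<close>

locale quandle =
  fixes Q :: "'a set" and qop :: "'a \<Rightarrow> 'a \<Rightarrow> 'a" (infixl \<open>\<triangleright>\<close> 70)
  assumes closed: "x \<in> Q \<Longrightarrow> y \<in> Q \<Longrightarrow> x \<triangleright> y \<in> Q"
    and idem: "x \<in> Q \<Longrightarrow> x \<triangleright> x = x"
    and distrib: "x \<in> Q \<Longrightarrow> y \<in> Q \<Longrightarrow> z \<in> Q \<Longrightarrow> x \<triangleright> (y \<triangleright> z) = (x \<triangleright> y) \<triangleright> (x \<triangleright> z)"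
    and unique_solution: "x \<in> Q \<Longrightarrow> y \<in> Q \<Longrightarrow> \<exists>!z. z \<in> Q \<and> x \<triangleright> z = y"

definition left_mult :: "'a set \<Rightarrow> ('a \<Rightarrow> 'a \<Rightarrow> 'a) \<Rightarrow> 'a \<Rightarrow> 'a \<Rightarrow> 'a" where
  "left_mult Q qop x = (\<lambda>y\<in>Q. qop x y)"

definition Inn :: "'a set \<Rightarrow> ('a \<Rightarrow> 'a \<Rightarrow> 'a) \<Rightarrow> ('a \<Rightarrow> 'a) monoid" where
  "Inn Q qop = (BijGroup Q)\<lparr>carrier := generate (BijGroup Q) (left_mult Q qop ` Q)\<rparr>"

definition env_relations :: "'a set \<Rightarrow> ('a \<Rightarrow> 'a \<Rightarrow> 'a) \<Rightarrow> ('a word \<times> 'a word) set" where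
  "env_relations Q qop =
     {([(True, x), (True, y), (False, x)], [(True, qop x y)]) | x y. x \<in> Q \<and> y \<in> Q}"

definition env_group :: "'a set \<Rightarrow> ('a \<Rightarrow> 'a \<Rightarrow> 'a) \<Rightarrow> 'a word set monoid" where
  "env_group Q qop = pres_group Q (env_relations Q qop)"

definition env_phi :: "'a set \<Rightarrow> ('a \<Rightarrow> 'a \<Rightarrow> 'a) \<Rightarrow> 'a \<Rightarrow> 'a word set" where
  "env_phi Q qop = pres_gen Q (env_relations Q qop)"

definition env_theta :: "'a set \<Rightarrow> ('a \<Rightarrow> 'a \<Rightarrow> 'a) \<Rightarrow> 'a word set \<Rightarrow> 'a \<Rightarrow> 'a" where
  "env_theta Q qop = pres_hom (Inn Q qop) (left_mult Q qop)"

definition Z0 :: "'a set \<Rightarrow> ('a \<Rightarrow> 'a \<Rightarrow> 'a) \<Rightarrow> 'a word set monoid" where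
  "Z0 Q qop =
     (env_group Q qop)\<lparr>carrier := kernel (env_group Q qop) (Inn Q qop) (env_theta Q qop)\<rparr>"

definition torsion :: "('g, 'm) monoid_scheme \<Rightarrow> 'g set" where
  "torsion G = {x \<in> carrier G. \<exists>n>0. x [^]\<^bsub>G\<^esub> (n::nat) = \<one>\<^bsub>G\<^esub>}"

definition Tor :: "('g, 'm) monoid_scheme \<Rightarrow> ('g, 'm) monoid_scheme" where
  "Tor G = G\<lparr>carrier := torsion G\<rparr>"

text \<open>\<open>\<alpha>\<close> has domain \<open>Tor Z\<^sub>0 \<times> Z\<^sub>0/Tor Z\<^sub>0\<close>; the second summand is embedded as \<open>{\<one>} \<times> Z\<^sub>0/Tor Z\<^sub>0\<close>.\<close>

definition alpha_image ::
  "'a set \<Rightarrow> ('a \<Rightarrow> 'a \<Rightarrow> 'a) \<Rightarrow> ('a word set \<times> 'a word set set \<Rightarrow> 'a word set) \<Rightarrow> 'a word set set" where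
  "alpha_image Q qop \<alpha> =
     \<alpha> ` ({\<one>\<^bsub>Tor (Z0 Q qop)\<^esub>} \<times> carrier (Z0 Q qop Mod torsion (Z0 Q qop)))"

definition env_quot ::
  "'a set \<Rightarrow> ('a \<Rightarrow> 'a \<Rightarrow> 'a) \<Rightarrow> ('a word set \<times> 'a word set set \<Rightarrow> 'a word set) \<Rightarrow> 'a word set set monoid" where
  "env_quot Q qop \<alpha> = env_group Q qop Mod alpha_image Q qop \<alpha>"

definition env_q ::
  "'a set \<Rightarrow> ('a \<Rightarrow> 'a \<Rightarrow> 'a) \<Rightarrow> ('a word set \<times> 'a word set set \<Rightarrow> 'a word set) \<Rightarrow> 'a word set \<Rightarrow> 'a word set set" where
  "env_q Q qop \<alpha> g = alpha_image Q qop \<alpha> #>\<^bsub>env_group Q qop\<^esub> g"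

definition env_quot_phi ::
  "'a set \<Rightarrow> ('a \<Rightarrow> 'a \<Rightarrow> 'a) \<Rightarrow> ('a word set \<times> 'a word set set \<Rightarrow> 'a word set) \<Rightarrow> 'a \<Rightarrow> 'a word set set" where
  "env_quot_phi Q qop \<alpha> = env_q Q qop \<alpha> \<circ> env_phi Q qop"

lemma group_env_group: "group (env_group Q qop)"
  by (simp add: env_group_def group_pres_group)

lemma env_phi_carrier: "x \<in> Q \<Longrightarrow> env_phi Q qop x \<in> carrier (env_group Q qop)"
  by (simp add: env_phi_def env_group_def pres_gen_carrier)

context quandle
begin

lemma left_mult_Bij:
  assumes "x \<in> Q"
  shows "left_mult Q (\<triangleright>) x \<in> Bij Q"
proof -
  have "bij_betw (left_mult Q (\<triangleright>) x) Q Q"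
    unfolding bij_betw_def
  proof
    show "inj_on (left_mult Q (\<triangleright>) x) Q"
      using unique_solution[OF assms closed[OF assms]] by (auto simp: inj_on_def left_mult_def)
    show "left_mult Q (\<triangleright>) x ` Q = Q"
    proof
      show "left_mult Q (\<triangleright>) x ` Q \<subseteq> Q" using closed[OF assms] by (auto simp: left_mult_def)
      show "Q \<subseteq> left_mult Q (\<triangleright>) x ` Q"
      proof
        fix y assume "y \<in> Q"
        then obtain z where "z \<in> Q" "x \<triangleright> z = y" using unique_solution[OF assms] by blast
        then show "y \<in> left_mult Q (\<triangleright>) x ` Q" by (intro image_eqI[of _ _ z]) (simp_all add: left_mult_def)
      qed
    qed
  qed
  then show ?thesis by (simp add: Bij_def left_mult_def)
qed

lemma subgroup_Inn: "subgroup (carrier (Inn Q (\<triangleright>))) (BijGroup Q)"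
  unfolding Inn_def
  using group.generate_is_subgroup[OF group_BijGroup, of "left_mult Q (\<triangleright>) ` Q" Q] left_mult_Bij
  by (auto simp: BijGroup_def)

lemma group_Inn: "group (Inn Q (\<triangleright>))"
  using subgroup.subgroup_is_group[OF subgroup_Inn group_BijGroup] by (simp add: Inn_def)

lemma left_mult_Inn: "left_mult Q (\<triangleright>) ` Q \<subseteq> carrier (Inn Q (\<triangleright>))"
  by (auto simp: Inn_def intro: generate.incl)

lemma mult_Inn:
  "f \<in> carrier (Inn Q (\<triangleright>)) \<Longrightarrow> g \<in> carrier (Inn Q (\<triangleright>)) \<Longrightarrow> f \<otimes>\<^bsub>Inn Q (\<triangleright>)\<^esub> g = compose Q f g"
  using subgroup.subset[OF subgroup_Inn] by (auto simp: Inn_def BijGroup_def)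

lemma env_phi_op:
  assumes x: "x \<in> Q" and y: "y \<in> Q"
  shows "env_phi Q (\<triangleright>) x \<otimes>\<^bsub>env_group Q (\<triangleright>)\<^esub> env_phi Q (\<triangleright>) y \<otimes>\<^bsub>env_group Q (\<triangleright>)\<^esub>
      inv\<^bsub>env_group Q (\<triangleright>)\<^esub> env_phi Q (\<triangleright>) x = env_phi Q (\<triangleright>) (x \<triangleright> y)"
proof -
  have "pres_eq Q (env_relations Q (\<triangleright>)) [(True, x), (True, y), (False, x)] [(True, x \<triangleright> y)]"
    using x y closed by (intro pres_eq.rel) (auto simp: env_relations_def)
  from pres_class_eq[OF this] show ?thesis
    using x y by (simp add: env_phi_def env_group_def inv_pres_gen)
      (simp add: pres_gen_def pres_mult_class)
qed

lemma left_mult_op: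
  assumes x: "x \<in> Q" and y: "y \<in> Q"
  shows "left_mult Q (\<triangleright>) x \<otimes>\<^bsub>Inn Q (\<triangleright>)\<^esub> left_mult Q (\<triangleright>) y \<otimes>\<^bsub>Inn Q (\<triangleright>)\<^esub>
      inv\<^bsub>Inn Q (\<triangleright>)\<^esub> left_mult Q (\<triangleright>) x = left_mult Q (\<triangleright>) (x \<triangleright> y)"
proof -
  interpret I: group "Inn Q (\<triangleright>)" by (rule group_Inn)
  have L: "left_mult Q (\<triangleright>) z \<in> carrier (Inn Q (\<triangleright>))" if "z \<in> Q" for z
    using left_mult_Inn that by auto
  have xy: "x \<triangleright> y \<in> Q" using closed x y .
  have "left_mult Q (\<triangleright>) x \<otimes>\<^bsub>Inn Q (\<triangleright>)\<^esub> left_mult Q (\<triangleright>) y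
      = left_mult Q (\<triangleright>) (x \<triangleright> y) \<otimes>\<^bsub>Inn Q (\<triangleright>)\<^esub> left_mult Q (\<triangleright>) x"
    unfolding mult_Inn[OF L[OF x] L[OF y]] mult_Inn[OF L[OF xy] L[OF x]] compose_def
    by (rule restrict_ext) (simp add: left_mult_def distrib[OF x y] closed x y)
  then show ?thesis
    using L[OF x] L[OF y] L[OF xy] by (simp add: I.m_assoc)
qed

lemma word_eval_env_relations:
  assumes "(u, v) \<in> env_relations Q (\<triangleright>)"
  shows "word_eval (Inn Q (\<triangleright>)) (left_mult Q (\<triangleright>)) u = word_eval (Inn Q (\<triangleright>)) (left_mult Q (\<triangleright>)) v"
proof -
  interpret I: group "Inn Q (\<triangleright>)" by (rule group_Inn)
  obtain x y where uv: "x \<in> Q" "y \<in> Q" "u = [(True, x), (True, y), (False, x)]" "v = [(True, x \<triangleright> y)]"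
    using assms by (auto simp: env_relations_def)
  have L: "left_mult Q (\<triangleright>) z \<in> carrier (Inn Q (\<triangleright>))" if "z \<in> Q" for z
    using left_mult_Inn that by auto
  show ?thesis
    using left_mult_op[OF uv(1,2)] uv L closed by (simp add: I.m_assoc)
qed

lemma env_theta_hom: "env_theta Q (\<triangleright>) \<in> hom (env_group Q (\<triangleright>)) (Inn Q (\<triangleright>))"
  unfolding env_theta_def env_group_def
  by (rule group.pres_hom_hom[OF group_Inn left_mult_Inn word_eval_env_relations])

lemma env_theta_phi: "x \<in> Q \<Longrightarrow> env_theta Q (\<triangleright>) (env_phi Q (\<triangleright>) x) = left_mult Q (\<triangleright>) x"
  unfolding env_theta_def env_phi_def
  by (rule group.pres_hom_hom[OF group_Inn left_mult_Inn word_eval_env_relations])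

lemma group_hom_theta: "group_hom (env_group Q (\<triangleright>)) (Inn Q (\<triangleright>)) (env_theta Q (\<triangleright>))"
  by (simp add: group_hom_def group_hom_axioms_def group_env_group group_Inn env_theta_hom)

lemma env_theta_surj: "env_theta Q (\<triangleright>) ` carrier (env_group Q (\<triangleright>)) = carrier (Inn Q (\<triangleright>))"
proof -
  interpret group_hom "env_group Q (\<triangleright>)" "Inn Q (\<triangleright>)" "env_theta Q (\<triangleright>)" by (rule group_hom_theta)
  have L: "left_mult Q (\<triangleright>) x \<in> env_theta Q (\<triangleright>) ` carrier (env_group Q (\<triangleright>))" if "x \<in> Q" for x
    using env_theta_phi[OF that] env_phi_carrier[OF that] by (metis imageI)
  have "g \<in> env_theta Q (\<triangleright>) ` carrier (env_group Q (\<triangleright>))"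
    if "g \<in> generate (BijGroup Q) (left_mult Q (\<triangleright>) ` Q)" for g
    using that
  proof (induction rule: generate.induct)
    case one
    then show ?case using subgroup.one_closed[OF img_is_subgroup] by (simp add: Inn_def)
  next
    case (incl h)
    then show ?case using L by auto
  next
    case (inv h)
    then have "inv\<^bsub>BijGroup Q\<^esub> h = inv\<^bsub>Inn Q (\<triangleright>)\<^esub> h"
      using group.m_inv_consistent[OF group_BijGroup subgroup_Inn, of h] left_mult_Inn
      by (auto simp: Inn_def)
    then show ?case using inv L subgroup.m_inv_closed[OF img_is_subgroup] by auto
  next
    case (eng h1 h2)
    then show ?case using subgroup.m_closed[OF img_is_subgroup, of h1 h2] by (simp add: Inn_def)
  qed
  then show ?thesis using hom_closed by (auto simp: Inn_def)
qed

lemma env_conj: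
  assumes "w \<in> words Q" "x \<in> Q"
  shows "word_eval (Inn Q (\<triangleright>)) (left_mult Q (\<triangleright>)) w x \<in> Q \<and>
    pres_rel Q (env_relations Q (\<triangleright>)) `` {w} \<otimes>\<^bsub>env_group Q (\<triangleright>)\<^esub> env_phi Q (\<triangleright>) x =
    env_phi Q (\<triangleright>) (word_eval (Inn Q (\<triangleright>)) (left_mult Q (\<triangleright>)) w x) \<otimes>\<^bsub>env_group Q (\<triangleright>)\<^esub>
      pres_rel Q (env_relations Q (\<triangleright>)) `` {w}"
  using assms(1)
proof (induction w)
  interpret G: group "env_group Q (\<triangleright>)" by (rule group_env_group)
  {
    case Nil
    have "pres_rel Q (env_relations Q (\<triangleright>)) `` {[]} = \<one>\<^bsub>env_group Q (\<triangleright>)\<^esub>"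
      by (simp add: env_group_def pres_one)
    moreover have "word_eval (Inn Q (\<triangleright>)) (left_mult Q (\<triangleright>)) [] x = x"
      using assms(2) by (simp add: Inn_def BijGroup_def)
    ultimately show ?case using env_phi_carrier[of x Q "(\<triangleright>)"] assms(2) by simp
  next
    case (Cons a w)
    obtain b y where a: "a = (b, y)" by (cases a)
    have y: "y \<in> Q" and w: "w \<in> words Q" using Cons.prems by (simp_all add: a)
    define z where "z = word_eval (Inn Q (\<triangleright>)) (left_mult Q (\<triangleright>)) w x"
    define W where "W = pres_rel Q (env_relations Q (\<triangleright>)) `` {w}"
    let ?p = "env_phi Q (\<triangleright>)"
    define A where "A = (if b then ?p y else inv\<^bsub>env_group Q (\<triangleright>)\<^esub> ?p y)"
    define l where "l = (if b then left_mult Q (\<triangleright>) y else inv\<^bsub>Inn Q (\<triangleright>)\<^esub> left_mult Q (\<triangleright>) y)"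
    have z: "z \<in> Q" and IH: "W \<otimes>\<^bsub>env_group Q (\<triangleright>)\<^esub> ?p x = ?p z \<otimes>\<^bsub>env_group Q (\<triangleright>)\<^esub> W"
      using Cons.IH w by (auto simp: z_def W_def)
    have p: "?p v \<in> carrier (env_group Q (\<triangleright>))" if "v \<in> Q" for v
      using that by (rule env_phi_carrier)
    have W: "W \<in> carrier (env_group Q (\<triangleright>))"
      using w by (simp add: W_def env_group_def pres_class_carrier)
    have A: "A \<in> carrier (env_group Q (\<triangleright>))" using p[OF y] by (simp add: A_def)
    have aw: "pres_rel Q (env_relations Q (\<triangleright>)) `` {a # w} = A \<otimes>\<^bsub>env_group Q (\<triangleright>)\<^esub> W"
      using y w by (simp add: A_def W_def a env_phi_def env_group_def inv_pres_gen)
        (simp add: pres_gen_def pres_mult_class)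
    interpret I: group "Inn Q (\<triangleright>)" by (rule group_Inn)
    have Ly: "left_mult Q (\<triangleright>) y \<in> carrier (Inn Q (\<triangleright>))" using left_mult_Inn y by auto
    have l: "l \<in> carrier (Inn Q (\<triangleright>))" using Ly by (simp add: l_def)
    have "word_eval (Inn Q (\<triangleright>)) (left_mult Q (\<triangleright>)) w \<in> carrier (Inn Q (\<triangleright>))"
      using I.word_eval_closed[OF left_mult_Inn w] .
    then have ev: "word_eval (Inn Q (\<triangleright>)) (left_mult Q (\<triangleright>)) (a # w) x = l z"
      using mult_Inn[OF l] assms(2) by (simp add: a l_def z_def compose_def)
    have "l \<in> Bij Q" using l subgroup.subset[OF subgroup_Inn] by (auto simp: BijGroup_def)
    then have lz: "l z \<in> Q" using z Bij_imp_funcset by blast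
    have "A \<otimes>\<^bsub>env_group Q (\<triangleright>)\<^esub> ?p z = ?p (l z) \<otimes>\<^bsub>env_group Q (\<triangleright>)\<^esub> A"
    proof (cases b)
      case True
      have "?p (y \<triangleright> z) \<otimes>\<^bsub>env_group Q (\<triangleright>)\<^esub> ?p y = ?p y \<otimes>\<^bsub>env_group Q (\<triangleright>)\<^esub> ?p z"
        using env_phi_op[OF y z, symmetric] p[OF y] p[OF z] by (simp add: G.m_assoc)
      then show ?thesis using True z by (simp add: A_def l_def left_mult_def)
    next
      case False
      have "left_mult Q (\<triangleright>) y \<otimes>\<^bsub>Inn Q (\<triangleright>)\<^esub> l = \<one>\<^bsub>Inn Q (\<triangleright>)\<^esub>"
        using False Ly by (simp add: l_def)
      then have "compose Q (left_mult Q (\<triangleright>) y) l = (\<lambda>v\<in>Q. v)"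
        using mult_Inn[OF Ly l] by (simp add: Inn_def BijGroup_def)
      from fun_cong[OF this, of z] have "y \<triangleright> l z = z"
        using z lz by (simp add: compose_def left_mult_def)
      then have pz: "?p z = ?p y \<otimes>\<^bsub>env_group Q (\<triangleright>)\<^esub> ?p (l z) \<otimes>\<^bsub>env_group Q (\<triangleright>)\<^esub> inv\<^bsub>env_group Q (\<triangleright>)\<^esub> ?p y"
        using env_phi_op[OF y lz] by simp
      show ?thesis
        using False p[OF y] p[OF lz] unfolding pz
        by (simp add: A_def) (simp add: G.m_assoc[symmetric])
    qed
    then have "A \<otimes>\<^bsub>env_group Q (\<triangleright>)\<^esub> W \<otimes>\<^bsub>env_group Q (\<triangleright>)\<^esub> ?p x
        = ?p (l z) \<otimes>\<^bsub>env_group Q (\<triangleright>)\<^esub> (A \<otimes>\<^bsub>env_group Q (\<triangleright>)\<^esub> W)"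
      using A W p[OF z] p[OF lz] p[OF assms(2)] IH by (metis G.m_assoc)
    then show ?case unfolding aw ev using lz by simp
  }
qed

lemma Z0_central:
  assumes "g \<in> carrier (Z0 Q (\<triangleright>))" and "h \<in> carrier (env_group Q (\<triangleright>))"
  shows "g \<otimes>\<^bsub>env_group Q (\<triangleright>)\<^esub> h = h \<otimes>\<^bsub>env_group Q (\<triangleright>)\<^esub> g"
proof -
  interpret G: group "env_group Q (\<triangleright>)" by (rule group_env_group)
  have g: "g \<in> carrier (env_group Q (\<triangleright>))" and "env_theta Q (\<triangleright>) g = \<one>\<^bsub>Inn Q (\<triangleright>)\<^esub>"
    using assms(1) by (auto simp: Z0_def kernel_def)
  obtain w where w: "w \<in> words Q" "g = pres_rel Q (env_relations Q (\<triangleright>)) `` {w}"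
    using g by (auto simp: env_group_def elim: pres_carrierE)
  have "word_eval (Inn Q (\<triangleright>)) (left_mult Q (\<triangleright>)) w = \<one>\<^bsub>Inn Q (\<triangleright>)\<^esub>"
    using group.pres_hom_class[OF group_Inn left_mult_Inn word_eval_env_relations w(1)]
      \<open>env_theta Q (\<triangleright>) g = _\<close> by (simp add: env_theta_def w(2))
  then have ev: "word_eval (Inn Q (\<triangleright>)) (left_mult Q (\<triangleright>)) w x = x" if "x \<in> Q" for x
    using that by (simp add: Inn_def BijGroup_def)
  have gen: "g \<otimes>\<^bsub>env_group Q (\<triangleright>)\<^esub> env_phi Q (\<triangleright>) x = env_phi Q (\<triangleright>) x \<otimes>\<^bsub>env_group Q (\<triangleright>)\<^esub> g"
    if "x \<in> Q" for x
    using env_conj[OF w(1) that] ev[OF that] by (simp add: w(2))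
  have inv: "g \<otimes>\<^bsub>env_group Q (\<triangleright>)\<^esub> inv\<^bsub>env_group Q (\<triangleright>)\<^esub> env_phi Q (\<triangleright>) x
      = inv\<^bsub>env_group Q (\<triangleright>)\<^esub> env_phi Q (\<triangleright>) x \<otimes>\<^bsub>env_group Q (\<triangleright>)\<^esub> g" if "x \<in> Q" for x
    using gen[OF that] g env_phi_carrier[OF that, of "(\<triangleright>)"]
    by (metis G.inv_solve_left G.inv_solve_right' G.m_assoc G.inv_closed G.m_closed)
  have "g \<otimes>\<^bsub>env_group Q (\<triangleright>)\<^esub> word_eval (env_group Q (\<triangleright>)) (env_phi Q (\<triangleright>)) u
      = word_eval (env_group Q (\<triangleright>)) (env_phi Q (\<triangleright>)) u \<otimes>\<^bsub>env_group Q (\<triangleright>)\<^esub> g" if "u \<in> words Q" for u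
    using that
  proof (induction u)
    case Nil
    then show ?case using g by simp
  next
    case (Cons a u)
    obtain b x where a: "a = (b, x)" by (cases a)
    have x: "x \<in> Q" and u: "u \<in> words Q" using Cons.prems by (simp_all add: a)
    define A where "A = (if b then env_phi Q (\<triangleright>) x else inv\<^bsub>env_group Q (\<triangleright>)\<^esub> env_phi Q (\<triangleright>) x)"
    have A: "A \<in> carrier (env_group Q (\<triangleright>))" using env_phi_carrier[OF x] by (simp add: A_def)
    have gA: "g \<otimes>\<^bsub>env_group Q (\<triangleright>)\<^esub> A = A \<otimes>\<^bsub>env_group Q (\<triangleright>)\<^esub> g"
      using gen[OF x] inv[OF x] by (simp add: A_def)
    have "word_eval (env_group Q (\<triangleright>)) (env_phi Q (\<triangleright>)) u \<in> carrier (env_group Q (\<triangleright>))"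
      using u env_phi_carrier by (intro G.word_eval_closed[of _ Q]) auto
    then have "g \<otimes>\<^bsub>env_group Q (\<triangleright>)\<^esub> (A \<otimes>\<^bsub>env_group Q (\<triangleright>)\<^esub> word_eval (env_group Q (\<triangleright>)) (env_phi Q (\<triangleright>)) u)
      = A \<otimes>\<^bsub>env_group Q (\<triangleright>)\<^esub> word_eval (env_group Q (\<triangleright>)) (env_phi Q (\<triangleright>)) u \<otimes>\<^bsub>env_group Q (\<triangleright>)\<^esub> g"
      using A g gA Cons.IH[OF u] by (metis G.m_assoc)
    then show ?case by (simp add: a A_def)
  qed
  moreover obtain u where "u \<in> words Q" "h = pres_rel Q (env_relations Q (\<triangleright>)) `` {u}"
    using assms(2) by (auto simp: env_group_def elim: pres_carrierE)
  ultimately show ?thesis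
    using word_eval_pres_gen[of u Q "env_relations Q (\<triangleright>)"] unfolding env_group_def env_phi_def
    by metis
qed

lemma subgroup_Z0: "subgroup (carrier (Z0 Q (\<triangleright>))) (env_group Q (\<triangleright>))"
  using group_hom.subgroup_kernel[OF group_hom_theta] by (simp add: Z0_def)

lemma comm_group_Z0: "comm_group (Z0 Q (\<triangleright>))"
proof -
  have "group (Z0 Q (\<triangleright>))"
    using subgroup.subgroup_is_group[OF subgroup_Z0 group_env_group] by (simp add: Z0_def)
  moreover have "x \<otimes>\<^bsub>Z0 Q (\<triangleright>)\<^esub> y = y \<otimes>\<^bsub>Z0 Q (\<triangleright>)\<^esub> x"
    if "x \<in> carrier (Z0 Q (\<triangleright>))" "y \<in> carrier (Z0 Q (\<triangleright>))" for x y
    using Z0_central[OF that(1)] that(2) subgroup.subset[OF subgroup_Z0] by (auto simp: Z0_def)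
  ultimately show ?thesis by (rule group.group_comm_groupI)
qed

end

lemma (in comm_group) subgroup_torsion: "subgroup (torsion G) G"
proof (rule subgroupI)
  show "torsion G \<noteq> {}" unfolding torsion_def by (auto intro!: exI[of _ \<one>] exI[of _ 1])
  show "inv a \<in> torsion G" if "a \<in> torsion G" for a
    using that by (auto simp: torsion_def nat_pow_inv)
  show "a \<otimes> b \<in> torsion G" if "a \<in> torsion G" "b \<in> torsion G" for a b
  proof -
    obtain m n :: nat where *: "a \<in> carrier G" "b \<in> carrier G" "m > 0" "n > 0" "a [^] m = \<one>" "b [^] n = \<one>"
      using \<open>a \<in> torsion G\<close> \<open>b \<in> torsion G\<close> by (auto simp: torsion_def)
    have "a [^] (m * n) = (a [^] m) [^] n" "b [^] (m * n) = (b [^] n) [^] m"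
      using *(1,2) by (simp_all only: nat_pow_pow mult.commute[of n m])
    then have "(a \<otimes> b) [^] (m * n) = \<one>"
      using * by (simp add: pow_mult_distrib m_comm)
    then show ?thesis using * by (auto simp: torsion_def intro!: exI[of _ "m * n"])
  qed
qed (auto simp: torsion_def)

context quandle
begin

lemma alpha_image_normal:
  assumes \<alpha>: "\<alpha> \<in> iso (Tor (Z0 Q (\<triangleright>)) \<times>\<times> (Z0 Q (\<triangleright>) Mod torsion (Z0 Q (\<triangleright>)))) (Z0 Q (\<triangleright>))"
  shows "alpha_image Q (\<triangleright>) \<alpha> \<lhd> env_group Q (\<triangleright>)"
proof -
  interpret G: group "env_group Q (\<triangleright>)" by (rule group_env_group)
  interpret Z: comm_group "Z0 Q (\<triangleright>)" by (rule comm_group_Z0)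
  let ?T = "torsion (Z0 Q (\<triangleright>))"
  have nT: "?T \<lhd> Z0 Q (\<triangleright>)" using Z.subgroup_torsion by (rule Z.subgroup_imp_normal)
  have T: "group (Tor (Z0 Q (\<triangleright>)))"
    using subgroup.subgroup_is_group[OF Z.subgroup_torsion Z.is_group] by (simp add: Tor_def)
  have F: "group (Z0 Q (\<triangleright>) Mod ?T)" using nT by (rule normal.factorgroup_is_group)
  let ?P = "Tor (Z0 Q (\<triangleright>)) \<times>\<times> (Z0 Q (\<triangleright>) Mod ?T)"
  interpret P: group ?P using T F by (rule DirProd_group)
  interpret h: group_hom ?P "Z0 Q (\<triangleright>)" \<alpha>
    using \<alpha> by unfold_locales (simp add: iso_def)
  have "subgroup ({\<one>\<^bsub>Tor (Z0 Q (\<triangleright>))\<^esub>} \<times> carrier (Z0 Q (\<triangleright>) Mod ?T)) ?P"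
    using DirProd_subgroups[OF T group.triv_subgroup[OF T] F group.subgroup_self[OF F]] .
  then have subZ: "subgroup (alpha_image Q (\<triangleright>) \<alpha>) (Z0 Q (\<triangleright>))"
    unfolding alpha_image_def by (rule h.subgroup_img_is_subgroup)
  have N: "subgroup (alpha_image Q (\<triangleright>) \<alpha>) (env_group Q (\<triangleright>))"
    using G.incl_subgroup[OF subgroup_Z0] subZ by (simp add: Z0_def)
  have sub: "alpha_image Q (\<triangleright>) \<alpha> \<subseteq> carrier (Z0 Q (\<triangleright>))"
    using subZ by (rule subgroup.subset)
  show ?thesis
  proof (rule G.normal_invI[OF N])
    fix x h assume x: "x \<in> carrier (env_group Q (\<triangleright>))" and h: "h \<in> alpha_image Q (\<triangleright>) \<alpha>"
    have hG: "h \<in> carrier (env_group Q (\<triangleright>))" using h N subgroup.subset by blast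
    have "x \<otimes>\<^bsub>env_group Q (\<triangleright>)\<^esub> h = h \<otimes>\<^bsub>env_group Q (\<triangleright>)\<^esub> x"
      using Z0_central[of h x] sub h x by auto
    then show "x \<otimes>\<^bsub>env_group Q (\<triangleright>)\<^esub> h \<otimes>\<^bsub>env_group Q (\<triangleright>)\<^esub> inv\<^bsub>env_group Q (\<triangleright>)\<^esub> x \<in> alpha_image Q (\<triangleright>) \<alpha>"
      using h hG x by (simp add: G.m_assoc)
  qed
qed

lemma group_env_quot:
  assumes "\<alpha> \<in> iso (Tor (Z0 Q (\<triangleright>)) \<times>\<times> (Z0 Q (\<triangleright>) Mod torsion (Z0 Q (\<triangleright>)))) (Z0 Q (\<triangleright>))"
  shows "group (env_quot Q (\<triangleright>) \<alpha>)"
  unfolding env_quot_def using alpha_image_normal[OF assms] by (rule normal.factorgroup_is_group)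

lemma env_q_hom:
  assumes "\<alpha> \<in> iso (Tor (Z0 Q (\<triangleright>)) \<times>\<times> (Z0 Q (\<triangleright>) Mod torsion (Z0 Q (\<triangleright>)))) (Z0 Q (\<triangleright>))"
  shows "env_q Q (\<triangleright>) \<alpha> \<in> hom (env_group Q (\<triangleright>)) (env_quot Q (\<triangleright>) \<alpha>)"
  unfolding env_quot_def env_q_def
  using normal.r_coset_hom_Mod[OF alpha_image_normal[OF assms]] by simp

end

section \<open>Representations and Hermitian spaces\<close>

locale hermitian_space = vector_space scale
  for scale :: "complex \<Rightarrow> 'v::ab_group_add \<Rightarrow> 'v" +
  fixes ip :: "'v \<Rightarrow> 'v \<Rightarrow> complex"
  assumes finite_dimensional: "\<exists>Basis. finite_dimensional_vector_space scale Basis"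
    and ip_add_left: "ip (u + v) w = ip u w + ip v w"
    and ip_scale_left: "ip (scale c v) w = c * ip v w"
    and ip_cnj: "ip w v = cnj (ip v w)"
    and ip_pos: "v \<noteq> 0 \<Longrightarrow> 0 < Re (ip v v)"

definition GL :: "(complex \<Rightarrow> 'v::ab_group_add \<Rightarrow> 'v) \<Rightarrow> ('v \<Rightarrow> 'v) monoid" where
  "GL scale = \<lparr>carrier = {f. Vector_Spaces.linear scale scale f \<and> bij f}, mult = (\<circ>), one = id\<rparr>"

definition unitary ::
  "(complex \<Rightarrow> 'v::ab_group_add \<Rightarrow> 'v) \<Rightarrow> ('v \<Rightarrow> 'v \<Rightarrow> complex) \<Rightarrow> ('v \<Rightarrow> 'v) set" where
  "unitary scale ip = {f \<in> carrier (GL scale). \<forall>v w. ip (f v) (f w) = ip v w}"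

definition irreducible_rep ::
  "('g, 'm) monoid_scheme \<Rightarrow> (complex \<Rightarrow> 'v::ab_group_add \<Rightarrow> 'v) \<Rightarrow> ('g \<Rightarrow> 'v \<Rightarrow> 'v) \<Rightarrow> bool" where
  "irreducible_rep G scale \<rho> \<longleftrightarrow>
     \<rho> \<in> hom G (GL scale) \<and> (UNIV :: 'v set) \<noteq> {0} \<and>
     (\<forall>W. module.subspace scale W \<and> (\<forall>g\<in>carrier G. \<rho> g ` W \<subseteq> W) \<longrightarrow> W = {0} \<or> W = UNIV)"

definition quandle_rep ::
  "'a set \<Rightarrow> ('a \<Rightarrow> 'a \<Rightarrow> 'a) \<Rightarrow> (complex \<Rightarrow> 'v::ab_group_add \<Rightarrow> 'v) \<Rightarrow> ('a \<Rightarrow> 'v \<Rightarrow> 'v) \<Rightarrow> bool" where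
  "quandle_rep Q qop scale \<rho> \<longleftrightarrow>
     (\<forall>x\<in>Q. \<rho> x \<in> carrier (GL scale)) \<and>
     (\<forall>x\<in>Q. \<forall>y\<in>Q. \<rho> (qop x y) = \<rho> x \<otimes>\<^bsub>GL scale\<^esub> \<rho> y \<otimes>\<^bsub>GL scale\<^esub> inv\<^bsub>GL scale\<^esub> \<rho> x)"

definition quandle_character :: "'a set \<Rightarrow> ('a \<Rightarrow> 'a \<Rightarrow> 'a) \<Rightarrow> ('a \<Rightarrow> complex) \<Rightarrow> bool" where
  "quandle_character Q qop \<chi> \<longleftrightarrow>
     (\<forall>x\<in>Q. \<chi> x \<noteq> 0) \<and> (\<forall>x\<in>Q. \<forall>y\<in>Q. \<chi> (qop x y) = \<chi> y)"

definition char_mult ::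
  "(complex \<Rightarrow> 'v \<Rightarrow> 'v) \<Rightarrow> ('a \<Rightarrow> complex) \<Rightarrow> ('a \<Rightarrow> 'v \<Rightarrow> 'v) \<Rightarrow> 'a \<Rightarrow> 'v \<Rightarrow> 'v" where
  "char_mult scale \<chi> \<rho> x = (\<lambda>v. scale (\<chi> x) (\<rho> x v))"

lemma GL_simps [simp]:
  "f \<in> carrier (GL scale) \<longleftrightarrow> Vector_Spaces.linear scale scale f \<and> bij f"
  "f \<otimes>\<^bsub>GL scale\<^esub> g = f \<circ> g" "\<one>\<^bsub>GL scale\<^esub> = id"
  by (simp_all add: GL_def)

lemma group_GL:
  assumes "vector_space scale"
  shows "group (GL scale)"
proof (rule groupI)
  interpret vector_space scale by (rule assms)
  show "\<one>\<^bsub>GL scale\<^esub> \<in> carrier (GL scale)" using linear_id by simp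
  fix f assume f: "f \<in> carrier (GL scale)"
  show "\<exists>g\<in>carrier (GL scale). g \<otimes>\<^bsub>GL scale\<^esub> f = \<one>\<^bsub>GL scale\<^esub>"
  proof (rule bexI[of _ "inv_into UNIV f"])
    interpret f: Vector_Spaces.linear scale scale f using f by simp
    have "inj f" "surj f" using f by (auto simp: bij_def)
    have "inv_into UNIV f (v + w) = inv_into UNIV f v + inv_into UNIV f w" for v w
      by (rule inv_f_eq[OF \<open>inj f\<close>]) (simp add: f.add surj_f_inv_f[OF \<open>surj f\<close>])
    moreover have "inv_into UNIV f (scale c v) = scale c (inv_into UNIV f v)" for c v
      by (rule inv_f_eq[OF \<open>inj f\<close>]) (simp add: f.scale surj_f_inv_f[OF \<open>surj f\<close>])
    ultimately have "Vector_Spaces.linear scale scale (inv_into UNIV f)"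
      using assms by (simp add: Vector_Spaces.linear_iff)
    then show "inv_into UNIV f \<in> carrier (GL scale)" using f by (simp add: bij_imp_bij_inv)
    show "inv_into UNIV f \<otimes>\<^bsub>GL scale\<^esub> f = \<one>\<^bsub>GL scale\<^esub>" using \<open>inj f\<close> by simp
  qed
qed (auto simp: bij_comp comp_assoc intro: Vector_Spaces.linear_compose)

lemma quandle_rep_char_mult:
  assumes "quandle Q qop"
    and \<alpha>: "\<alpha> \<in> iso (Tor (Z0 Q qop) \<times>\<times> (Z0 Q qop Mod torsion (Z0 Q qop))) (Z0 Q qop)"
    and "vector_space scale" and \<rho>: "\<rho> \<in> hom (env_quot Q qop \<alpha>) (GL scale)"
    and \<chi>: "quandle_character Q qop \<chi>"
  shows "quandle_rep Q qop scale (char_mult scale \<chi> (\<rho> \<circ> env_quot_phi Q qop \<alpha>))"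
proof -
  interpret quandle Q qop by (rule assms)
  interpret V: vector_space scale by (rule assms)
  interpret GLV: group "GL scale" using assms(3) by (rule group_GL)
  interpret E: group_hom "env_group Q qop" "GL scale" "\<rho> \<circ> env_q Q qop \<alpha>"
    using group_env_group env_q_hom[OF \<alpha>] \<rho>
    by (auto simp: group_hom_def group_hom_axioms_def GLV.is_group intro: hom_compose)
  define r where "r = \<rho> \<circ> env_quot_phi Q qop \<alpha>"
  define s where "s = char_mult scale \<chi> r"
  have r: "r x \<in> carrier (GL scale)" if "x \<in> Q" for x
    using E.hom_closed[OF env_phi_carrier[OF that]] unfolding r_def env_quot_phi_def comp_def .
  have s: "s x \<in> carrier (GL scale)" if x: "x \<in> Q" for x
  proof -
    interpret rx: Vector_Spaces.linear scale scale "r x" using r[OF x] by simp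
    have c: "\<chi> x \<noteq> 0" using \<chi> x by (simp add: quandle_character_def)
    have "Vector_Spaces.linear scale scale (\<lambda>v. scale (\<chi> x) (r x v))"
      using assms(3)
      by (simp add: Vector_Spaces.linear_iff rx.add rx.scale V.scale_right_distrib mult.commute)
    moreover have "bij (\<lambda>v. scale (\<chi> x) (r x v))"
    proof -
      have "bij (scale (\<chi> x))"
        by (rule o_bij[of "scale (1 / \<chi> x)"]) (simp_all add: c fun_eq_iff)
      then have "bij (scale (\<chi> x) \<circ> r x)" using r[OF x] by (intro bij_comp) auto
      then show ?thesis by (simp add: comp_def)
    qed
    ultimately show ?thesis by (simp add: s_def char_mult_def)
  qed
  have "s (qop x y) = s x \<otimes>\<^bsub>GL scale\<^esub> s y \<otimes>\<^bsub>GL scale\<^esub> inv\<^bsub>GL scale\<^esub> s x" if x: "x \<in> Q" and y: "y \<in> Q" for x y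
  proof (rule GLV.inv_solve_right[THEN iffD2])
    have "r (qop x y) = r x \<otimes>\<^bsub>GL scale\<^esub> r y \<otimes>\<^bsub>GL scale\<^esub> inv\<^bsub>GL scale\<^esub> r x"
    proof -
      note p = env_phi_carrier[of _ Q qop]
      have "r (qop x y) = (\<rho> \<circ> env_q Q qop \<alpha>) (env_phi Q qop (qop x y))"
        by (simp add: r_def env_quot_phi_def)
      also have "\<dots> = r x \<otimes>\<^bsub>GL scale\<^esub> r y \<otimes>\<^bsub>GL scale\<^esub> inv\<^bsub>GL scale\<^esub> r x"
        unfolding env_phi_op[OF x y, symmetric]
        using p[OF x] p[OF y] by (simp only: E.hom_mult E.hom_inv E.G.m_closed E.G.inv_closed)
          (simp add: r_def env_quot_phi_def)
      finally show ?thesis .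
    qed
    then have "r (qop x y) \<otimes>\<^bsub>GL scale\<^esub> r x = r x \<otimes>\<^bsub>GL scale\<^esub> r y"
      using GLV.inv_solve_right[of "r (qop x y)" "r x \<otimes>\<^bsub>GL scale\<^esub> r y" "r x"]
        r[OF x] r[OF y] r[OF closed[OF x y]] GLV.m_closed by metis
    then have e: "r (qop x y) (r x v) = r x (r y v)" for v by (simp add: fun_eq_iff)
    interpret rx: Vector_Spaces.linear scale scale "r x" using r[OF x] by simp
    interpret rxy: Vector_Spaces.linear scale scale "r (qop x y)" using r[OF closed[OF x y]] by simp
    have "\<chi> (qop x y) = \<chi> y" using \<chi> x y by (simp add: quandle_character_def)
    then show "s x \<otimes>\<^bsub>GL scale\<^esub> s y = s (qop x y) \<otimes>\<^bsub>GL scale\<^esub> s x"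
      by (simp add: fun_eq_iff s_def char_mult_def rx.scale rxy.scale e mult.commute)
  qed (use s x y closed GLV.m_closed in blast)+
  then show ?thesis using s by (simp add: quandle_rep_def s_def r_def)
qed

end

theory Submission
  imports Defs "HOL-Algebra.Multiplicative_Group"
begin

text \<open>Write \<open>r x\<close> for the operator that \<open>\<rho>\<close> assigns to the class of the generator of \<open>x \<in> Q\<close>.
  If \<open>\<bar>\<chi> x\<bar> = 1\<close>, then \<open>\<chi> x \<cdot> r x\<close> is unitary if and only if \<open>r x\<close> is, and \<open>\<rho>\<close> is unitary as soon
  as all the \<open>r x\<close> are, because their classes generate the group. What remains is that
  unitarity of \<open>\<chi> x \<cdot> r x\<close> forces \<open>\<bar>\<chi> x\<bar> = 1\<close> (\<open>norm_one_if_scaled_finite_order_isometry\<close>). This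
  holds because \<open>r x\<close> has finite order \<open>n\<close>: comparing the norm of a nonzero vector with that
  of its image under the \<open>n\<close>-th power of the isometry \<open>\<chi> x \<cdot> r x\<close> gives \<open>\<bar>\<chi> x\<bar> ^ n = 1\<close>.

  The order is finite because the quotient group is torsion (\<open>env_pow_in_alpha_image\<close>):
  since \<open>Q\<close> is finite, so is \<open>Inn Q\<close>, and a power \<open>z\<close> of any given element lies in \<open>Z\<^sub>0\<close>.
  Writing \<open>z = \<alpha> (t, c)\<close> with \<open>t ^ k = \<one>\<close>, the power \<open>z ^ k = \<alpha> (\<one>, c ^ k)\<close> is trivial in the quotient.\<close>

lemma (in quandle) finite_Inn:
  assumes "finite Q"
  shows "finite (carrier (Inn Q (\<triangleright>)))"
proof (rule finite_subset)
  show "carrier (Inn Q (\<triangleright>)) \<subseteq> Q \<rightarrow>\<^sub>E Q"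
    using subgroup.subset[OF subgroup_Inn]
    by (auto simp: BijGroup_def Bij_def PiE_def dest: bij_betw_imp_funcset)
  show "finite (Q \<rightarrow>\<^sub>E Q)" using assms by (intro finite_PiE)
qed

text \<open>\<open>G(Q) / Z\<^sub>0\<close> is isomorphic to the finite group \<open>Inn Q\<close>, whose order serves as exponent.\<close>

lemma (in quandle) env_pow_in_Z0:
  assumes "finite Q" and g: "g \<in> carrier (env_group Q (\<triangleright>))"
  shows "\<exists>n>0. g [^]\<^bsub>env_group Q (\<triangleright>)\<^esub> (n::nat) \<in> carrier (Z0 Q (\<triangleright>))"
proof -
  interpret \<theta>: group_hom "env_group Q (\<triangleright>)" "Inn Q (\<triangleright>)" "env_theta Q (\<triangleright>)" by (rule group_hom_theta)
  let ?n = "order (Inn Q (\<triangleright>))"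
  have "env_theta Q (\<triangleright>) (g [^]\<^bsub>env_group Q (\<triangleright>)\<^esub> ?n) = \<one>\<^bsub>Inn Q (\<triangleright>)\<^esub>"
    using \<theta>.H.pow_order_eq_1 g by (simp add: \<theta>.hom_nat_pow)
  moreover have "?n > 0"
    using \<theta>.H.order_gt_0_iff_finite finite_Inn[OF assms(1)] by simp
  ultimately show ?thesis
    using g by (intro exI[of _ ?n]) (simp add: Z0_def kernel_def)
qed

text \<open>A power of \<open>g\<close> lying in \<open>Z\<^sub>0\<close> need not lie in the torsion-free summand; raising it further to
  the order of its torsion component removes that component.\<close>

lemma (in quandle) env_pow_in_alpha_image:
  assumes "finite Q"
    and \<alpha>: "\<alpha> \<in> iso (Tor (Z0 Q (\<triangleright>)) \<times>\<times> (Z0 Q (\<triangleright>) Mod torsion (Z0 Q (\<triangleright>)))) (Z0 Q (\<triangleright>))"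
    and g: "g \<in> carrier (env_group Q (\<triangleright>))"
  shows "\<exists>n>0. g [^]\<^bsub>env_group Q (\<triangleright>)\<^esub> (n::nat) \<in> alpha_image Q (\<triangleright>) \<alpha>"
proof -
  let ?G = "env_group Q (\<triangleright>)" and ?Z = "Z0 Q (\<triangleright>)"
  let ?T = "torsion ?Z"
  interpret G: group ?G by (rule group_env_group)
  interpret Z: comm_group ?Z by (rule comm_group_Z0)
  interpret T: group "Tor ?Z"
    using subgroup.subgroup_is_group[OF Z.subgroup_torsion Z.is_group] by (simp add: Tor_def)
  interpret F: group "?Z Mod ?T"
    using Z.subgroup_imp_normal[OF Z.subgroup_torsion] by (rule normal.factorgroup_is_group)
  interpret P: group "Tor ?Z \<times>\<times> (?Z Mod ?T)"
    using T.is_group F.is_group by (rule DirProd_group)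
  interpret h: group_hom "Tor ?Z \<times>\<times> (?Z Mod ?T)" ?Z \<alpha>
    using \<alpha> by unfold_locales (simp add: iso_def)
  obtain m :: nat where m: "m > 0" "g [^]\<^bsub>?G\<^esub> m \<in> carrier ?Z"
    using env_pow_in_Z0[OF assms(1) g] by blast
  have pow_Z: "z [^]\<^bsub>?G\<^esub> k = z [^]\<^bsub>?Z\<^esub> k" for z and k :: nat
    by (simp add: Z0_def nat_pow_def)
  have pow_T: "t [^]\<^bsub>Tor ?Z\<^esub> k = t [^]\<^bsub>?Z\<^esub> k" for t and k :: nat
    by (simp add: Tor_def nat_pow_def)
  have "g [^]\<^bsub>?G\<^esub> m \<in> \<alpha> ` carrier (Tor ?Z \<times>\<times> (?Z Mod ?T))"
    using m(2) \<alpha> by (simp add: iso_def bij_betw_def)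
  then obtain t c where t: "t \<in> carrier (Tor ?Z)" and c: "c \<in> carrier (?Z Mod ?T)"
    and gm: "g [^]\<^bsub>?G\<^esub> m = \<alpha> (t, c)" by auto
  obtain k :: nat where k: "k > 0" "t [^]\<^bsub>?Z\<^esub> k = \<one>\<^bsub>?Z\<^esub>"
    using t by (auto simp: Tor_def torsion_def)
  have pow_P: "(t, c) [^]\<^bsub>Tor ?Z \<times>\<times> (?Z Mod ?T)\<^esub> j = (t [^]\<^bsub>Tor ?Z\<^esub> j, c [^]\<^bsub>?Z Mod ?T\<^esub> j)" for j :: nat
    by (induction j) auto
  have one: "\<one>\<^bsub>Tor ?Z\<^esub> = \<one>\<^bsub>?Z\<^esub>" by (simp add: Tor_def)
  have "g [^]\<^bsub>?G\<^esub> (m * k) = \<alpha> (t, c) [^]\<^bsub>?Z\<^esub> k"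
    using G.nat_pow_pow[OF g, of m k] gm pow_Z by simp
  also have "\<dots> = \<alpha> (\<one>\<^bsub>Tor ?Z\<^esub>, c [^]\<^bsub>?Z Mod ?T\<^esub> k)"
    using t c k(2) h.hom_nat_pow[of "(t, c)" k] by (simp add: pow_P pow_T one)
  finally have "g [^]\<^bsub>?G\<^esub> (m * k) \<in> alpha_image Q (\<triangleright>) \<alpha>"
    unfolding alpha_image_def using F.nat_pow_closed[OF c] by (simp add: image_eqI)
  then show ?thesis using m(1) k(1) by (intro exI[of _ "m * k"]) simp
qed

lemma (in group) word_eval_in_subgroup:
  assumes "subgroup H G" and "f ` X \<subseteq> H" and "w \<in> words X"
  shows "word_eval G f w \<in> H"
  using assms(3)
proof (induction w)
  case Nil
  then show ?case using subgroup.one_closed[OF assms(1)] by simp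
next
  case (Cons a w)
  then show ?case
    using assms(2) subgroup.m_closed[OF assms(1)] subgroup.m_inv_closed[OF assms(1)]
    by (cases a) (auto simp: image_subset_iff)
qed

lemma pow_GL:
  assumes "vector_space scale"
  shows "f [^]\<^bsub>GL scale\<^esub> (n::nat) = f ^^ n"
proof -
  interpret group "GL scale" using assms by (rule group_GL)
  show ?thesis by (induction n) (auto simp: funpow_Suc_right simp del: funpow.simps(2))
qed

context hermitian_space
begin

lemma ip_scale_scale: "ip (scale c v) (scale d w) = c * cnj d * ip v w"
  by (metis ip_cnj ip_scale_left complex_cnj_mult mult.assoc mult.left_commute)

lemma subgroup_unitary: "subgroup (unitary scale ip) (GL scale)"
proof -
  interpret GLV: group "GL scale" using vector_space_axioms by (rule group_GL)
  show ?thesis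
  proof (rule GLV.subgroupI)
    show "unitary scale ip \<subseteq> carrier (GL scale)" by (auto simp: unitary_def)
    show "unitary scale ip \<noteq> {}"
      using GLV.one_closed by (auto simp: unitary_def intro!: exI[of _ id])
  next
    fix f assume f: "f \<in> unitary scale ip"
    let ?g = "inv\<^bsub>GL scale\<^esub> f"
    have fG: "f \<in> carrier (GL scale)" using f unfolding unitary_def by blast
    have fg: "f (?g v) = v" for v
      using fun_cong[OF GLV.r_inv[OF fG], of v] by simp
    have "ip (?g v) (?g w) = ip v w" for v w
      using f fg[of v] fg[of w] unfolding unitary_def by (metis (mono_tags, lifting) mem_Collect_eq)
    then show "?g \<in> unitary scale ip"
      using GLV.inv_closed[OF fG] unfolding unitary_def by blast
  next
    fix f g assume "f \<in> unitary scale ip" "g \<in> unitary scale ip"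
    then show "f \<otimes>\<^bsub>GL scale\<^esub> g \<in> unitary scale ip"
      using GLV.m_closed[of f g] by (auto simp: unitary_def)
  qed
qed

text \<open>Only the norm of vectors has to be preserved, and \<open>f\<close> need not be linear: with \<open>\<parallel>\<cdot>\<parallel>\<close> the norm
  of \<open>ip\<close>, the hypothesis reads \<open>\<bar>c\<bar>\<^sup>2 \<parallel>f v\<parallel>\<^sup>2 = \<parallel>v\<parallel>\<^sup>2\<close>, which is iterated \<open>n\<close> times.\<close>

lemma norm_one_if_scaled_finite_order_isometry:
  fixes v :: 'v
  assumes iso: "\<And>v. ip (scale c (f v)) (scale c (f v)) = ip v v"
    and "n > 0" and "f ^^ n = id" and "v \<noteq> 0"
  shows "cmod c = 1"
proof -
  have step: "(c * cnj c) * ip (f u) (f u) = ip u u" for u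
    using iso[of u] by (simp add: ip_scale_scale)
  have "(c * cnj c) ^ j * ip ((f ^^ j) v) ((f ^^ j) v) = ip v v" for j
    by (induction j) (simp_all add: step[symmetric, of "(f ^^ _) v"] mult_ac)
  from this[of n] have "(c * cnj c) ^ n * ip v v = ip v v" using assms(3) by simp
  moreover have "ip v v \<noteq> 0" using ip_pos[OF assms(4)] by auto
  ultimately have "(c * cnj c) ^ n = 1" by simp
  then have "cmod (c * cnj c) = 1" using power_eq_1_iff assms(2) by blast
  then have "(cmod c)\<^sup>2 = 1" by (simp add: norm_mult power2_eq_square)
  then show ?thesis using norm_ge_zero[of c] by (auto simp: power2_eq_1_iff)
qed

end

theorem mainTheorem13:
  fixes Q :: "'a set" and qop :: "'a \<Rightarrow> 'a \<Rightarrow> 'a"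
    and \<alpha> :: "'a word set \<times> 'a word set set \<Rightarrow> 'a word set"
    and scale :: "complex \<Rightarrow> 'v::ab_group_add \<Rightarrow> 'v" and ip :: "'v \<Rightarrow> 'v \<Rightarrow> complex"
    and \<rho> :: "'a word set set \<Rightarrow> 'v \<Rightarrow> 'v"
    and \<chi> :: "'a \<Rightarrow> complex"
  assumes "quandle Q qop" and "finite Q"
    and "\<alpha> \<in> iso (Tor (Z0 Q qop) \<times>\<times> (Z0 Q qop Mod torsion (Z0 Q qop))) (Z0 Q qop)"
    and "hermitian_space scale ip"
    and "irreducible_rep (env_quot Q qop \<alpha>) scale \<rho>"
    and "quandle_character Q qop \<chi>"
  shows "(\<forall>x\<in>Q. char_mult scale \<chi> (\<rho> \<circ> env_quot_phi Q qop \<alpha>) x \<in> unitary scale ip) \<longleftrightarrow>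
         (\<forall>g\<in>carrier (env_quot Q qop \<alpha>). \<rho> g \<in> unitary scale ip) \<and> (\<forall>x\<in>Q. cmod (\<chi> x) = 1)"
proof -
  let ?r = "\<rho> \<circ> env_quot_phi Q qop \<alpha>" and ?G = "env_group Q qop"
  interpret quandle Q qop by (rule assms(1))
  interpret V: hermitian_space scale ip by (rule assms(4))
  have vs: "vector_space scale" by (rule V.vector_space_axioms)
  interpret GLV: group "GL scale" using vs by (rule group_GL)
  have \<rho>: "\<rho> \<in> hom (env_quot Q qop \<alpha>) (GL scale)" and nz: "(UNIV :: 'v set) \<noteq> {0}"
    using assms(5) by (auto simp: irreducible_rep_def)
  obtain v :: 'v where v: "v \<noteq> 0" using nz by auto
  note N = alpha_image_normal[OF assms(3)]
  interpret E: group_hom ?G "GL scale" "\<rho> \<circ> env_q Q qop \<alpha>"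
    using group_env_group env_q_hom[OF assms(3)] \<rho>
    by (auto simp: group_hom_def group_hom_axioms_def GLV.is_group intro: hom_compose)
  have r_eq: "?r x = (\<rho> \<circ> env_q Q qop \<alpha>) (env_phi Q qop x)" for x
    by (simp add: env_quot_phi_def)
  have r_GL: "?r x \<in> carrier (GL scale)" if "x \<in> Q" for x
    unfolding r_eq by (rule E.hom_closed[OF env_phi_carrier[OF that]])
  have r_q: "?r x \<in> \<rho> ` carrier (env_quot Q qop \<alpha>)" if "x \<in> Q" for x
    using hom_in_carrier[OF env_q_hom[OF assms(3)] env_phi_carrier[OF that]]
    by (simp add: env_quot_phi_def)
  have scaled_iso: "ip (scale c u) (scale c w) = ip u w" if "cmod c = 1" for c u w
    using complex_norm_square[of c] that by (simp add: V.ip_scale_scale)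
  have norm_one: "cmod (\<chi> x) = 1"
    if U: "char_mult scale \<chi> ?r x \<in> unitary scale ip" and x: "x \<in> Q" for x
  proof -
    obtain n :: nat where n: "n > 0" "env_phi Q qop x [^]\<^bsub>?G\<^esub> n \<in> alpha_image Q qop \<alpha>"
      using env_pow_in_alpha_image[OF assms(2,3) env_phi_carrier[OF x]] by blast
    have "env_q Q qop \<alpha> (env_phi Q qop x [^]\<^bsub>?G\<^esub> n) = env_q Q qop \<alpha> \<one>\<^bsub>?G\<^esub>"
      unfolding env_q_def
      using E.coset_join2[OF _ normal_imp_subgroup[OF N]] n(2) env_phi_carrier[OF x]
        normal_imp_subgroup[OF N, THEN subgroup.one_closed] by simp
    then have "?r x [^]\<^bsub>GL scale\<^esub> n = \<one>\<^bsub>GL scale\<^esub>"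
      using E.hom_nat_pow[OF env_phi_carrier[OF x], of n] E.hom_one unfolding r_eq by simp
    then have "?r x ^^ n = id" by (simp add: pow_GL[OF vs])
    moreover have "ip (scale (\<chi> x) (?r x u)) (scale (\<chi> x) (?r x u)) = ip u u" for u
      using U by (auto simp: unitary_def char_mult_def)
    ultimately show "cmod (\<chi> x) = 1"
      using V.norm_one_if_scaled_finite_order_isometry[of "\<chi> x" "?r x" n v] n(1) v by blast
  qed
  have rho_unitary: "\<rho> g \<in> unitary scale ip"
    if U: "\<And>x. x \<in> Q \<Longrightarrow> ?r x \<in> unitary scale ip" and g: "g \<in> carrier (env_quot Q qop \<alpha>)" for g
  proof -
    (* Every element of the quotient is the class of a word in the generators. *)
    obtain w where w: "w \<in> words Q"
      and g_eq: "g = env_q Q qop \<alpha> (pres_rel Q (env_relations Q qop) `` {w})"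
      using g by (auto simp: env_quot_def env_q_def FactGroup_def RCOSETS_def env_group_def
          elim: pres_carrierE)
    have "(\<rho> \<circ> env_q Q qop \<alpha>) (pres_rel Q (env_relations Q qop) `` {w}) = word_eval (GL scale) ?r w"
      using E.homh w unfolding env_group_def
      by (intro pres_hom_unique[of _ "\<rho> \<circ> env_q Q qop \<alpha>"] GLV.is_group) (simp_all only: r_eq env_phi_def)
    moreover have "word_eval (GL scale) ?r w \<in> unitary scale ip"
      using U by (intro GLV.word_eval_in_subgroup[OF V.subgroup_unitary _ w]) auto
    ultimately show ?thesis by (simp add: g_eq)
  qed
  show ?thesis
  proof (intro iffI conjI ballI)
    fix x assume "\<forall>x\<in>Q. char_mult scale \<chi> ?r x \<in> unitary scale ip" and "x \<in> Q"
    then show "cmod (\<chi> x) = 1" using norm_one by blast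
  next
    fix g assume U: "\<forall>x\<in>Q. char_mult scale \<chi> ?r x \<in> unitary scale ip"
      and g: "g \<in> carrier (env_quot Q qop \<alpha>)"
    have "?r x \<in> unitary scale ip" if x: "x \<in> Q" for x
    proof -
      have "char_mult scale \<chi> ?r x \<in> unitary scale ip" using U x by blast
      then show ?thesis
        using r_GL[OF x] scaled_iso[OF norm_one[OF _ x]] by (simp add: unitary_def char_mult_def)
    qed
    then show "\<rho> g \<in> unitary scale ip" using g by (rule rho_unitary)
  next
    fix x assume *: "(\<forall>g\<in>carrier (env_quot Q qop \<alpha>). \<rho> g \<in> unitary scale ip) \<and> (\<forall>x\<in>Q. cmod (\<chi> x) = 1)"
      and x: "x \<in> Q"
    have "char_mult scale \<chi> ?r x \<in> carrier (GL scale)"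
      using quandle_rep_char_mult[OF assms(1,3) vs \<rho> assms(6)] x by (simp add: quandle_rep_def)
    moreover have "?r x \<in> unitary scale ip" using * r_q[OF x] by auto
    ultimately show "char_mult scale \<chi> ?r x \<in> unitary scale ip"
      using * x scaled_iso by (simp add: unitary_def char_mult_def)
  qed
qed

end
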